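(* For every $n\ge 1$, $F_n(x)=P_n(x)$, where \[ F_n(x)=\sum_{w\in L(F_n)}\ \sum_{\sigma\in\mathcal{L}(F_n,w)}x^{\mathrm{des}_B(\sigma)} \qquad\text{and}\qquad P_n(x)=\sum_{\sigma\in P_n}x^{\mathrm{des}_B(\sigma)}. \]
   Context: A signed permutation on a multiset $M$ of positive integers is a word $\sigma=\sigma_1\cdots\sigma_m$ obtained by arranging the elements of $M$ in some order and possibly negating each letter. Letters are compared as integers. $P_n$ is the set of signed permutations on $\{1^2,2^2,\ldots,n^2\}$. Define $\mathrm{Des}_B(\sigma)=\{i:1\le i\le m-1,\ \sigma_i>\sigma_{i+1}\}\cup\{m \text{ if } \sigma_m>0\}$ and $\mathrm{des}_B(\sigma)=|\mathrm{Des}_B(\sigma)|$. Let $F_n$ be the forest consisting of $n$ trees $T_1,\ldots,T_n$. Each $T_i$ has exactly two vertices: a root $u_i$ and its child $v_i$. The forest is partially ordered by $x<_F y$ iff $y$ is a proper ancestor of $x$; thus $v_i<_F u_i$. A linear extension of $F_n$ is an ordering $x_{1}x_{2}\cdots x_{2n}$ of all vertices such that $x_j<_F x_k$ implies $j<k$. A signed labeling $w$ assigns to each vertex a nonzero integer, where the absolute values form a set of distinct positive integers. $\mathcal{L}(F_n,w)$ is the set of words $w(x_{1})\cdots w(x_{2n})$ obtained from the linear extensions $x_1\cdots x_{2n}$ of $F_n$. $L(F_n)$ is the set of signed labelings $w$ of $F_n$ such that, for each $i$, the pair $(w(u_i),w(v_i))$ is one of $(2i,2i-1)$, $(2i,-(2i-1))$,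 $(-2i,2i-1)$, $(-(2i-1),-2i)$. *)

theory Defs
  imports
    "HOL-Computational_Algebra.Polynomial"
    "HOL-Combinatorics.Multiset_Permutations"
    "HOL-Library.FuncSet"
begin

definition signed_permutations :: "nat multiset \<Rightarrow> int list set" where
  "signed_permutations M =
    {\<sigma>. \<exists>\<tau> \<in> permutations_of_multiset M.
          list_all2 (\<lambda>s t. s = int t \<or> s = - int t) \<sigma> \<tau>}"

definition P_set :: "nat \<Rightarrow> int list set" where
  "P_set n = signed_permutations (\<Sum>i\<in>{1..n}. replicate_mset 2 i)"

text \<open>Positions of a word are counted from 1, so the letter in position \<open>i\<close> is \<open>\<sigma> ! (i - 1)\<close>.\<close>

definition Des_B :: "int list \<Rightarrow> nat set" where
  "Des_B \<sigma> = {i. 1 \<le> i \<and> i < length \<sigma> \<and> \<sigma> ! (i - 1) > \<sigma> ! i} \<union>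
             (if \<sigma> \<noteq> [] \<and> last \<sigma> > 0 then {length \<sigma>} else {})"

definition des_B :: "int list \<Rightarrow> nat" where
  "des_B \<sigma> = card (Des_B \<sigma>)"

datatype vertex = U nat | V nat

definition forest_vertices :: "nat \<Rightarrow> vertex set" where
  "forest_vertices n = U ` {1..n} \<union> V ` {1..n}"

text \<open>Edges are pairs (child, parent), so the transitive closure relates a vertex to its
  proper ancestors.\<close>

definition forest_edges :: "nat \<Rightarrow> vertex rel" where
  "forest_edges n = {(V i, U i) | i. i \<in> {1..n}}"

definition forest_less :: "nat \<Rightarrow> vertex \<Rightarrow> vertex \<Rightarrow> bool" where
  "forest_less n x y \<longleftrightarrow> (x, y) \<in> (forest_edges n)\<^sup>+"

definition linear_extensions :: "'a set \<Rightarrow> ('a \<Rightarrow> 'a \<Rightarrow> bool) \<Rightarrow> 'a list set" where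
  "linear_extensions A lt =
    {xs. distinct xs \<and> set xs = A \<and>
         (\<forall>j < length xs. \<forall>k < length xs. lt (xs ! j) (xs ! k) \<longrightarrow> j < k)}"

text \<open>Labelings are \<open>undefined\<close> outside the vertex set, so that each labeling of the vertices
  is represented by exactly one function.\<close>

definition signed_labelings :: "'a set \<Rightarrow> ('a \<Rightarrow> int) set" where
  "signed_labelings A =
    {w \<in> extensional A. (\<forall>x\<in>A. w x \<noteq> 0) \<and> inj_on (\<lambda>x. \<bar>w x\<bar>) A}"

definition extension_words :: "nat \<Rightarrow> (vertex \<Rightarrow> int) \<Rightarrow> int list set" where
  "extension_words n w = map w ` linear_extensions (forest_vertices n) (forest_less n)"

definition L_set :: "nat \<Rightarrow> (vertex \<Rightarrow> int) set" where
  "L_set n = {w \<in> signed_labelings (forest_vertices n).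
     \<forall>i\<in>{1..n}. (w (U i), w (V i)) \<in>
       {(2 * int i, 2 * int i - 1), (2 * int i, - (2 * int i - 1)),
        (- (2 * int i), 2 * int i - 1), (- (2 * int i - 1), - (2 * int i))}}"

definition F_poly :: "nat \<Rightarrow> int poly" where
  "F_poly n = (\<Sum>w\<in>L_set n. \<Sum>\<sigma>\<in>extension_words n w. monom 1 (des_B \<sigma>))"

definition P_poly :: "nat \<Rightarrow> int poly" where
  "P_poly n = (\<Sum>\<sigma>\<in>P_set n. monom 1 (des_B \<sigma>))"

text \<open>The index sets of the sums above are finite, so the sums are not degenerate.\<close>

lemma finite_P_set: "finite (P_set n)"
proof -
  define M where "M = (\<Sum>i\<in>{1..n}. replicate_mset 2 i)"
  have "P_set n \<subseteq> {\<sigma>. set \<sigma> \<subseteq> (\<Union>t\<in>set_mset M. {int t, - int t}) \<and> length \<sigma> = size M}"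
  proof
    fix \<sigma> assume "\<sigma> \<in> P_set n"
    then obtain \<tau> where t: "mset \<tau> = M"
      and l: "list_all2 (\<lambda>s t. s = int t \<or> s = - int t) \<sigma> \<tau>"
      by (auto simp: P_set_def signed_permutations_def M_def permutations_of_multiset_def)
    have len: "length \<sigma> = size M"
      using t list_all2_lengthD[OF l] by (metis size_mset)
    have "s \<in> (\<Union>t\<in>set_mset M. {int t, - int t})" if s: "s \<in> set \<sigma>" for s
    proof -
      obtain i where i: "i < length \<sigma>" "s = \<sigma> ! i" using s by (metis in_set_conv_nth)
      have "\<tau> ! i \<in> set_mset M"
        using i list_all2_lengthD[OF l] t by (metis nth_mem set_mset_mset)
      moreover have "s = int (\<tau> ! i) \<or> s = - int (\<tau> ! i)"
        using list_all2_nthD[OF l i(1)] i by simp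
      ultimately show ?thesis by blast
    qed
    with len show "\<sigma> \<in> {\<sigma>. set \<sigma> \<subseteq> (\<Union>t\<in>set_mset M. {int t, - int t}) \<and> length \<sigma> = size M}"
      by blast
  qed
  moreover have "finite {\<sigma>. set \<sigma> \<subseteq> (\<Union>t\<in>set_mset M. {int t, - int t}) \<and> length \<sigma> = size M}"
    by (rule finite_lists_length_eq) simp
  ultimately show ?thesis by (rule finite_subset)
qed

lemma finite_forest_vertices: "finite (forest_vertices n)"
  by (simp add: forest_vertices_def)

lemma finite_extension_words: "finite (extension_words n w)"
proof -
  let ?A = "forest_vertices n"
  have "linear_extensions ?A (forest_less n) \<subseteq> {xs. set xs \<subseteq> ?A \<and> length xs \<le> card ?A}"
  proof
    fix xs assume "xs \<in> linear_extensions ?A (forest_less n)"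
    then have "distinct xs" and A: "set xs = ?A" unfolding linear_extensions_def by blast+
    then have "length xs = card ?A" by (metis distinct_card)
    with A show "xs \<in> {xs. set xs \<subseteq> ?A \<and> length xs \<le> card ?A}" by simp
  qed
  moreover have "finite {xs. set xs \<subseteq> ?A \<and> length xs \<le> card ?A}"
    by (rule finite_lists_length_le[OF finite_forest_vertices])
  ultimately have "finite (linear_extensions ?A (forest_less n))" by (rule finite_subset)
  then show ?thesis unfolding extension_words_def by (rule finite_imageI)
qed

lemma finite_L_set: "finite (L_set n)"
proof -
  have "L_set n \<subseteq> (\<Pi>\<^sub>E x\<in>forest_vertices n. {- (2 * int n)..2 * int n})"
  proof
    fix w assume w: "w \<in> L_set n"
    have "w (U i) \<in> {- (2 * int n)..2 * int n} \<and> w (V i) \<in> {- (2 * int n)..2 * int n}"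
      if "i \<in> {1..n}" for i
    proof -
      have "(w (U i), w (V i)) \<in>
         {(2 * int i, 2 * int i - 1), (2 * int i, - (2 * int i - 1)),
          (- (2 * int i), 2 * int i - 1), (- (2 * int i - 1), - (2 * int i))}"
        using w that unfolding L_set_def by blast
      moreover have "1 \<le> int i" "int i \<le> int n" using that by auto
      ultimately show ?thesis by (elim insertE emptyE) simp_all
    qed
    then have "w x \<in> {- (2 * int n)..2 * int n}" if "x \<in> forest_vertices n" for x
      using that unfolding forest_vertices_def by (elim UnE imageE) simp_all
    moreover have "w \<in> extensional (forest_vertices n)"
      using w unfolding L_set_def signed_labelings_def by simp
    ultimately show "w \<in> (\<Pi>\<^sub>E x\<in>forest_vertices n. {- (2 * int n)..2 * int n})"
      by (simp add: PiE_def Pi_def)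
  qed
  moreover have "finite (\<Pi>\<^sub>E x\<in>forest_vertices n. {- (2 * int n)..2 * int n})"
    by (intro finite_PiE finite_forest_vertices) simp
  ultimately show ?thesis by (rule finite_subset)
qed

end

theory Submission imports Defs begin

text \<open>
  Collapse the labels \<open>2i - 1\<close> and \<open>2i\<close> to \<open>i\<close>, keeping signs. The four admissible label pairs of the
  tree \<open>T\<^sub>i\<close> realise the four sign patterns of the two copies of \<open>i\<close>, once each; they are
  chosen so that whenever both labels have the same sign the child, which comes first in a linear
  extension, carries the smaller one. Hence two letters that become equal were not in descending
  order, so the collapse preserves descents, and it is a bijection because a linear extension can be
  recovered from the collapsed word: the first copy of \<open>i\<close> is \<open>v\<^sub>i\<close>, the second is \<open>u\<^sub>i\<close>.
\<close>

section \<open>Collapsing labels to signed tree indices\<close>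

fun vertex_index :: "vertex \<Rightarrow> nat" where
  "vertex_index (U i) = i"
| "vertex_index (V i) = i"

text \<open>As \<open>div\<close> rounds towards minus infinity, the fibres over i and -i, for i >=
  1, are {2i - 1, 2i} and {-2i, 1 - 2i}; the shift by one serves the positive side only.\<close>

definition collapse :: "int \<Rightarrow> int" where
  "collapse k = (if k > 0 then (k + 1) div 2 else k div 2)"

lemma collapse_mono: "a \<le> b \<Longrightarrow> collapse a \<le> collapse b"
  unfolding collapse_def by (auto split: if_splits)

lemma collapse_pos_iff: "collapse k > 0 \<longleftrightarrow> k > 0"
  unfolding collapse_def by auto

lemma collapse_double [simp]:
  "collapse (2 * int i) = int i"
  "collapse (- (2 * int i)) = - int i"
  unfolding collapse_def by auto

lemma collapse_double_diff [simp]: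
  assumes "1 \<le> i"
  shows "collapse (2 * int i - 1) = int i" "collapse (1 - 2 * int i) = - int i"
  using assms unfolding collapse_def by auto

text \<open>The trees have depth one: no edge starts where another ends, so the transitive closure
  adds nothing.\<close>

lemma forest_less_iff: "forest_less n x y \<longleftrightarrow> (\<exists>i\<in>{1..n}. x = V i \<and> y = U i)"
proof -
  have "trans (forest_edges n)"
    unfolding forest_edges_def trans_def by auto
  then have "(forest_edges n)\<^sup>+ = forest_edges n"
    by (rule trancl_id)
  then show ?thesis
    unfolding forest_less_def forest_edges_def by auto
qed

section \<open>Admissible labelings and sign patterns\<close>

lemma L_set_cases:
  assumes "w \<in> L_set n" "i \<in> {1..n}"
  obtains "w (U i) = 2 * int i" "w (V i) = 2 * int i - 1"
  | "w (U i) = 2 * int i" "w (V i) = 1 - 2 * int i"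
  | "w (U i) = - (2 * int i)" "w (V i) = 2 * int i - 1"
  | "w (U i) = 1 - 2 * int i" "w (V i) = - (2 * int i)"
  using assms unfolding L_set_def by fastforce

lemma abs_collapse_label:
  assumes "w \<in> L_set n" "x \<in> forest_vertices n"
  shows "\<bar>collapse (w x)\<bar> = int (vertex_index x)"
proof -
  define i where "i = vertex_index x"
  have i: "i \<in> {1..n}" and x: "x = U i \<or> x = V i"
    using assms(2) unfolding forest_vertices_def i_def by auto
  have "1 \<le> i" using i by simp
  from L_set_cases[OF assms(1) i] show ?thesis
    using x \<open>1 \<le> i\<close> by cases auto
qed

text \<open>Collapsing keeps signs, and the four admissible pairs have pairwise different sign
  patterns, so the signs at \<open>U i\<close> and \<open>V i\<close> determine both labels.\<close>

lemma L_set_collapse_inj: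
  assumes "w \<in> L_set n" "w' \<in> L_set n"
    and eq: "\<And>x. x \<in> forest_vertices n \<Longrightarrow> collapse (w x) = collapse (w' x)"
  shows "w = w'"
proof (rule extensionalityI[where A = "forest_vertices n"])
  show "w \<in> extensional (forest_vertices n)" "w' \<in> extensional (forest_vertices n)"
    using assms(1,2) unfolding L_set_def signed_labelings_def by auto
next
  fix x assume "x \<in> forest_vertices n"
  define i where "i = vertex_index x"
  have i: "i \<in> {1..n}" and x: "x = U i \<or> x = V i"
    using \<open>x \<in> forest_vertices n\<close> unfolding forest_vertices_def i_def by auto
  then have "1 \<le> i" by simp
  have "U i \<in> forest_vertices n" "V i \<in> forest_vertices n"
    using i unfolding forest_vertices_def by auto
  then have e: "collapse (w (U i)) = collapse (w' (U i))" "collapse (w (V i)) = collapse (w' (V i))"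
    using eq by auto
  from L_set_cases[OF assms(1) i] show "w x = w' x"
    by (cases; rule L_set_cases[OF assms(2) i]) (use x e \<open>1 \<le> i\<close> in auto)
qed

text \<open>As \<open>collapse\<close> is monotone, only a tie could lose a strict inequality. A tie
  puts \<open>x\<close> and \<open>y\<close> into one tree, and \<open>less\<close> then leaves
  \<open>x = V i\<close>, \<open>y = U i\<close>. Labels of equal sign are smaller at the child, so
  both sides are false.\<close>

lemma collapse_less_iff:
  assumes w: "w \<in> L_set n" and x: "x \<in> forest_vertices n" and y: "y \<in> forest_vertices n"
    and "x \<noteq> y" and less: "\<not> forest_less n y x"
  shows "collapse (w y) < collapse (w x) \<longleftrightarrow> w y < w x"
proof (cases "collapse (w x) = collapse (w y)")
  case False
  then show ?thesis
    using collapse_mono[of "w x" "w y"] collapse_mono[of "w y" "w x"] by linarith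
next
  case True
  then have "vertex_index x = vertex_index y"
    using abs_collapse_label[OF w x] abs_collapse_label[OF w y] by simp
  then obtain i where i: "i \<in> {1..n}" "x = V i" "y = U i"
    using x y \<open>x \<noteq> y\<close> less unfolding forest_vertices_def forest_less_iff by auto
  then have "1 \<le> i" by simp
  from L_set_cases[OF w i(1)] show ?thesis
    using True i \<open>1 \<le> i\<close> by cases auto
qed

lemma L_set_realises_signs:
  assumes t: "\<And>x. x \<in> forest_vertices n \<Longrightarrow> \<bar>t x\<bar> = int (vertex_index x)"
  shows "\<exists>w\<in>L_set n. \<forall>x\<in>forest_vertices n. collapse (w x) = t x"
proof -
  \<comment> \<open>The signs of \<open>t\<close> on a tree select its admissible pair. The absolute
    values 2i - 1 and 2i are exchanged exactly when both signs are negative, hence the negative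
    branches also consult the other vertex.\<close>
  define f where "f x = (case x of
      U i \<Rightarrow> if t (U i) > 0 then 2 * int i
             else if t (V i) > 0 then - (2 * int i) else 1 - 2 * int i
    | V i \<Rightarrow> if t (V i) > 0 then 2 * int i - 1
             else if t (U i) > 0 then 1 - 2 * int i else - (2 * int i))" for x
  define w where "w = restrict f (forest_vertices n)"
  have fU: "\<bar>f (U i)\<bar> \<in> {2 * int i - 1, 2 * int i}"
    and fV: "\<bar>f (V i)\<bar> \<in> {2 * int i - 1, 2 * int i}"
    and fUV: "\<bar>f (U i)\<bar> \<noteq> \<bar>f (V i)\<bar>" if "1 \<le> i" for i
    using that unfolding f_def by auto
  have nz: "f x \<noteq> 0" if "x \<in> forest_vertices n" for x
    using that fU fV unfolding forest_vertices_def by fastforce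
  \<comment> \<open>The absolute labels of different trees lie in disjoint pairs {2i - 1, 2i}.
    Injectivity thus reduces to the two vertices of one tree, which is \<open>fUV\<close>.\<close>
  have idx: "(\<bar>f x\<bar> + 1) div 2 = int (vertex_index x)" if "x \<in> forest_vertices n" for x
    using that fU fV unfolding forest_vertices_def by fastforce
  have inj: "inj_on (\<lambda>x. \<bar>f x\<bar>) (forest_vertices n)"
  proof (rule inj_onI)
    fix x y
    assume x: "x \<in> forest_vertices n" and y: "y \<in> forest_vertices n" and e: "\<bar>f x\<bar> = \<bar>f y\<bar>"
    have "vertex_index x = vertex_index y"
      using idx[OF x] idx[OF y] e by simp
    then show "x = y"
      using x y e fUV unfolding forest_vertices_def by fastforce
  qed
  have "w \<in> signed_labelings (forest_vertices n)"
    using nz inj unfolding signed_labelings_def w_def by (auto simp: inj_on_def)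
  moreover have "(w (U i), w (V i)) \<in>
       {(2 * int i, 2 * int i - 1), (2 * int i, - (2 * int i - 1)),
        (- (2 * int i), 2 * int i - 1), (- (2 * int i - 1), - (2 * int i))}"
    if "i \<in> {1..n}" for i
    using that unfolding w_def f_def forest_vertices_def by auto
  ultimately have "w \<in> L_set n"
    unfolding L_set_def by blast
  moreover have "collapse (w x) = t x" if x: "x \<in> forest_vertices n" for x
    using x t[OF x] unfolding w_def by (auto simp: f_def forest_vertices_def abs_if split: if_splits)
  ultimately show ?thesis by blast
qed

section \<open>Descents under relabelling\<close>

lemma des_B_map_cong:
  assumes desc: "\<And>i. 1 \<le> i \<Longrightarrow> i < length xs \<Longrightarrow>
      f (xs ! (i - 1)) > f (xs ! i) \<longleftrightarrow> g (xs ! (i - 1)) > g (xs ! i)"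
    and pos: "\<And>x. x \<in> set xs \<Longrightarrow> f x > 0 \<longleftrightarrow> g x > 0"
  shows "des_B (map f xs) = des_B (map g xs)"
proof -
  have "xs \<noteq> [] \<Longrightarrow> f (last xs) > 0 \<longleftrightarrow> g (last xs) > 0"
    using pos by simp
  moreover have "{i. 1 \<le> i \<and> i < length xs \<and> map f xs ! (i - 1) > map f xs ! i} =
      {i. 1 \<le> i \<and> i < length xs \<and> map g xs ! (i - 1) > map g xs ! i}"
    using desc by auto
  ultimately show ?thesis
    unfolding des_B_def Des_B_def by (cases "xs = []") (simp_all add: last_map)
qed

section \<open>Recovering a linear extension from its indices\<close>

text \<open>Restating the order condition through prefixes suits induction on appending a vertex at
  the end.\<close>

lemma linear_extensions_forest_iff:
  "xs \<in> linear_extensions (forest_vertices n) (forest_less n) \<longleftrightarrow>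
    distinct xs \<and> set xs = forest_vertices n \<and>
    (\<forall>k<length xs. \<forall>i. xs ! k = U i \<longrightarrow> V i \<in> set (take k xs))"
    (is "?L \<longleftrightarrow> ?R")
proof
  assume L: ?L
  have "V i \<in> set (take k xs)" if k: "k < length xs" "xs ! k = U i" for k i
  proof -
    have "U i \<in> forest_vertices n"
      using L k nth_mem[OF k(1)] unfolding linear_extensions_def by auto
    then have i: "i \<in> {1..n}" and "V i \<in> set xs"
      using L unfolding linear_extensions_def forest_vertices_def by auto
    then obtain j where j: "j < length xs" "xs ! j = V i"
      by (auto simp: in_set_conv_nth)
    then have "j < k"
      using L k i unfolding linear_extensions_def forest_less_iff by auto
    then show ?thesis
      using j k by (auto simp: in_set_conv_nth)
  qed
  with L show ?R
    unfolding linear_extensions_def by auto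
next
  assume R: ?R
  have "j < k" if "j < length xs" "k < length xs" "xs ! j = V i" "xs ! k = U i" for j k i
  proof -
    have "V i \<in> set (take k xs)"
      using R that by blast
    then obtain j' where "j' < k" "xs ! j' = V i"
      by (auto simp: in_set_conv_nth)
    \<comment> \<open>Distinctness makes \<open>j'\<close> the only position of \<open>V i\<close>,
      so \<open>j = j'\<close>.\<close>
    then show ?thesis
      using R that nth_eq_iff_index_eq[of xs j j'] by auto
  qed
  with R show ?L
    unfolding linear_extensions_def forest_less_iff by auto
qed

text \<open>Inverse of reading off indices. Every copy after the first becomes \<open>U\<close>, so
  the vertices are distinct only when no letter occurs more than twice.\<close>

definition occurrence_vertices :: "nat list \<Rightarrow> vertex list" where
  "occurrence_vertices \<tau> =
    map (\<lambda>k. if \<tau> ! k \<in> set (take k \<tau>) then U (\<tau> ! k) else V (\<tau> ! k)) [0..<length \<tau>]"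

lemma length_occurrence_vertices [simp]: "length (occurrence_vertices \<tau>) = length \<tau>"
  unfolding occurrence_vertices_def by simp

lemma nth_occurrence_vertices:
  "k < length \<tau> \<Longrightarrow>
    occurrence_vertices \<tau> ! k = (if \<tau> ! k \<in> set (take k \<tau>) then U (\<tau> ! k) else V (\<tau> ! k))"
  unfolding occurrence_vertices_def by simp

lemma occurrence_vertices_Nil [simp]: "occurrence_vertices [] = []"
  unfolding occurrence_vertices_def by simp

text \<open>Each entry depends only on earlier letters, so appending leaves the old entries
  unchanged; the reverse inductions rest on this.\<close>

lemma occurrence_vertices_snoc [simp]:
  "occurrence_vertices (\<tau> @ [i]) = occurrence_vertices \<tau> @ [if i \<in> set \<tau> then U i else V i]"
  unfolding occurrence_vertices_def by (auto simp: nth_append)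

lemma map_index_occurrence_vertices [simp]: "map vertex_index (occurrence_vertices \<tau>) = \<tau>"
  by (induction \<tau> rule: rev_induct) auto

lemma set_occurrence_vertices:
  "set (occurrence_vertices \<tau>) = V ` set \<tau> \<union> U ` {i. count (mset \<tau>) i \<ge> 2}"
proof (induction \<tau> rule: rev_induct)
  case (snoc i \<tau>)
  have pos: "i \<in> set \<tau> \<Longrightarrow> Suc 0 \<le> count (mset \<tau>) i"
    and zero: "i \<notin> set \<tau> \<Longrightarrow> count (mset \<tau>) i = 0"
    by (simp_all add: count_mset_0_iff)
  have "{j. count (mset (\<tau> @ [i])) j \<ge> 2} =
      {j. count (mset \<tau>) j \<ge> 2} \<union> (if i \<in> set \<tau> then {i} else {})"
    by (auto simp: pos zero)
  then show ?case
    using snoc by auto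
qed simp

lemma distinct_occurrence_vertices:
  "(\<And>i. count (mset \<tau>) i \<le> 2) \<Longrightarrow> distinct (occurrence_vertices \<tau>)"
proof (induction \<tau> rule: rev_induct)
  case (snoc i \<tau>)
  have "count (mset \<tau>) j \<le> 2" for j
    using snoc.prems[of j] by (auto split: if_splits)
  \<comment> \<open>At most one copy of \<open>i\<close> precedes the appended one, so
    \<open>U i\<close> is not yet present; \<open>V i\<close> is appended only when \<open>i\<close>
    is new.\<close>
  moreover have "count (mset \<tau>) i < 2"
    using snoc.prems[of i] by simp
  ultimately show ?case
    using snoc.IH by (auto simp: set_occurrence_vertices)
qed simp

text \<open>Makes a linear extension determined by its indices, as injectivity of the bijection
  requires.\<close>

lemma occurrence_vertices_map_index:
  assumes "distinct xs" "\<forall>k<length xs. \<forall>i. xs ! k = U i \<longrightarrow> V i \<in> set (take k xs)"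
  shows "occurrence_vertices (map vertex_index xs) = xs"
  using assms
proof (induction xs rule: rev_induct)
  case (snoc x xs)
  have ord: "\<forall>k<length xs. \<forall>i. xs ! k = U i \<longrightarrow> V i \<in> set (take k xs)"
  proof (intro allI impI)
    fix k i assume "k < length xs" "xs ! k = U i"
    then show "V i \<in> set (take k xs)"
      using snoc.prems(2)[rule_format, of k i] by (simp add: nth_append)
  qed
  then have IH: "occurrence_vertices (map vertex_index xs) = xs"
    using snoc.IH snoc.prems(1) by simp
  have before: "V i \<in> set xs" if "U i \<in> set xs" for i
    using ord that by (metis in_set_conv_nth in_set_takeD)
  have last: "x = U i \<Longrightarrow> V i \<in> set xs" for i
    using snoc.prems(2)[rule_format, of "length xs" i] by simp
  have "(if vertex_index x \<in> vertex_index ` set xs then U (vertex_index x)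
      else V (vertex_index x)) = x"
  proof (cases x)
    case (U i)
    then show ?thesis using last[of i] by force
  next
    case (V i)
    \<comment> \<open>An earlier vertex of tree \<open>i\<close> would be \<open>V i\<close>,
      against distinctness, or \<open>U i\<close>, which by \<open>before\<close> brings
      \<open>V i\<close> with it.\<close>
    have "j \<noteq> i" if "U j \<in> set xs \<or> V j \<in> set xs" for j
      using that before V snoc.prems(1) by auto
    then have "i \<notin> vertex_index ` set xs"
      by (metis imageE vertex.exhaust vertex_index.simps)
    then show ?thesis using V by simp
  qed
  then show ?case using IH by simp
qed simp

section \<open>The bijection with signed permutations\<close>

text \<open>The unsigned word is determined by absolute values, which removes the existential. The
  two equal summands correspond to roots and children of the forest.\<close>

lemma P_set_iff:
  "\<sigma> \<in> P_set n \<longleftrightarrow> mset (map (nat \<circ> abs) \<sigma>) = mset_set {1..n} + mset_set {1..n}"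
proof -
  have "list_all2 (\<lambda>s t. s = int t \<or> s = - int t) \<sigma> \<tau> \<longleftrightarrow> \<tau> = map (nat \<circ> abs) \<sigma>" for \<tau>
  proof
    show "list_all2 (\<lambda>s t. s = int t \<or> s = - int t) \<sigma> \<tau> \<Longrightarrow> \<tau> = map (nat \<circ> abs) \<sigma>"
      by (induction rule: list_all2_induct) auto
    show "\<tau> = map (nat \<circ> abs) \<sigma> \<Longrightarrow> list_all2 (\<lambda>s t. s = int t \<or> s = - int t) \<sigma> \<tau>"
      by (auto simp: list_all2_conv_all_nth)
  qed
  moreover have "(\<Sum>i\<in>{1..n}. replicate_mset 2 i) = mset_set {1..n} + mset_set {1..n}"
  proof -
    have "replicate_mset 2 i = {#i#} + {#i#}" for i :: nat
      by (simp add: numeral_2_eq_2)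
    then show ?thesis
      by (simp only: sum.distrib sum_multiset_singleton)
  qed
  ultimately show ?thesis
    unfolding P_set_def signed_permutations_def permutations_of_multiset_def by auto
qed

lemma image_mset_index_forest_vertices:
  "image_mset vertex_index (mset_set (forest_vertices n)) = mset_set {1..n} + mset_set {1..n}"
proof -
  have "mset_set (forest_vertices n) = mset_set (U ` {1..n}) + mset_set (V ` {1..n})"
    unfolding forest_vertices_def by (rule mset_set_Union) auto
  also have "\<dots> = image_mset U (mset_set {1..n}) + image_mset V (mset_set {1..n})"
    by (simp add: image_mset_mset_set inj_on_def)
  finally show ?thesis
    by (simp add: multiset.map_comp comp_def)
qed

text \<open>The absolute values of the collapsed word yield \<open>xs\<close>; its signs then yield
  \<open>w\<close>.\<close>

lemma collapse_word_bij:
  "bij_betw (\<lambda>(w, xs). map (collapse \<circ> w) xs)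
    (L_set n \<times> linear_extensions (forest_vertices n) (forest_less n)) (P_set n)"
    (is "bij_betw ?\<phi> (L_set n \<times> ?E) _")
proof -
  have index: "map (nat \<circ> abs) (map (collapse \<circ> w) xs) = map vertex_index xs"
    if "w \<in> L_set n" "xs \<in> ?E" for w xs
    using that abs_collapse_label[OF that(1)] unfolding linear_extensions_def by auto
  have inj: "inj_on ?\<phi> (L_set n \<times> ?E)"
  proof (rule inj_onI, clarify)
    fix w xs w' xs'
    assume w: "w \<in> L_set n" "w' \<in> L_set n" and xs: "xs \<in> ?E" "xs' \<in> ?E"
      and eq: "map (collapse \<circ> w) xs = map (collapse \<circ> w') xs'"
    have "map vertex_index xs = map vertex_index xs'"
      using index w xs eq by metis
    then have "xs = xs'"
      using xs unfolding linear_extensions_forest_iff by (metis occurrence_vertices_map_index)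
    moreover have "w = w'"
      using w
    proof (rule L_set_collapse_inj)
      fix x assume "x \<in> forest_vertices n"
      then show "collapse (w x) = collapse (w' x)"
        using eq \<open>xs = xs'\<close> xs unfolding linear_extensions_def by auto
    qed
    ultimately show "w = w' \<and> xs = xs'" by simp
  qed
  have "?\<phi> (w, xs) \<in> P_set n" if w: "w \<in> L_set n" and xs: "xs \<in> ?E" for w xs
  proof -
    have "mset xs = mset_set (forest_vertices n)"
      using xs unfolding linear_extensions_def by (auto simp flip: mset_set_set)
    then have "mset (map vertex_index xs) = mset_set {1..n} + mset_set {1..n}"
      using image_mset_index_forest_vertices by simp
    then show ?thesis
      unfolding P_set_iff prod.case index[OF w xs] .
  qed
  moreover have "\<sigma> \<in> ?\<phi> ` (L_set n \<times> ?E)" if "\<sigma> \<in> P_set n" for \<sigma>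
  proof -
    define \<tau> where "\<tau> = map (nat \<circ> abs) \<sigma>"
    define xs where "xs = occurrence_vertices \<tau>"
    have mset: "mset \<tau> = mset_set {1..n} + mset_set {1..n}"
      using that unfolding P_set_iff \<tau>_def .
    then have count: "count (mset \<tau>) i = (if i \<in> {1..n} then 2 else 0)" for i
      by (simp add: count_mset_set')
    have "set \<tau> = {1..n}"
      using arg_cong[OF mset, of set_mset] by simp
    then have "set xs = forest_vertices n"
      unfolding xs_def set_occurrence_vertices forest_vertices_def count by auto
    moreover have "distinct xs"
      unfolding xs_def by (rule distinct_occurrence_vertices) (simp add: count)
    moreover have "V i \<in> set (take k xs)" if "k < length xs" "xs ! k = U i" for k i
    proof -
      have k: "k < length \<tau>" using that unfolding xs_def by simp
      \<comment> \<open>Prefixes commute with \<open>occurrence_vertices\<close>, so an earlier copy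
        of \<open>i\<close> in \<open>\<tau>\<close> puts \<open>V i\<close> among the earlier
        vertices.\<close>
      have "take k xs = occurrence_vertices (take k \<tau>)"
        unfolding xs_def by (rule nth_equalityI) (use k in \<open>auto simp: nth_occurrence_vertices min_def\<close>)
      moreover have "i \<in> set (take k \<tau>)"
        using that k unfolding xs_def by (auto simp: nth_occurrence_vertices split: if_splits)
      ultimately show ?thesis
        by (simp add: set_occurrence_vertices)
    qed
    ultimately have xs: "xs \<in> ?E"
      unfolding linear_extensions_forest_iff by blast
    have len: "length xs = length \<sigma>" unfolding xs_def \<tau>_def by simp
    \<comment> \<open>Transfers the letters of \<open>\<sigma>\<close> to the vertices in the same
      positions. As \<open>xs\<close> is distinct, as long as \<open>\<sigma>\<close> and covers the
      forest, \<open>the\<close> meets no \<open>None\<close> on forest vertices.\<close>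
    define t where "t x = the (map_of (zip xs \<sigma>) x)" for x
    have t_nth: "t (xs ! k) = \<sigma> ! k" if "k < length xs" for k
      using that len \<open>distinct xs\<close> unfolding t_def by (simp add: map_of_zip_nth)
    have "\<bar>t x\<bar> = int (vertex_index x)" if x: "x \<in> forest_vertices n" for x
    proof -
      obtain k where k: "k < length xs" "x = xs ! k"
        using x \<open>set xs = forest_vertices n\<close> by (metis in_set_conv_nth)
      have "vertex_index x = map vertex_index xs ! k"
        using k by simp
      also have "\<dots> = \<tau> ! k"
        unfolding xs_def by simp
      also have "\<dots> = nat \<bar>\<sigma> ! k\<bar>"
        using k len unfolding \<tau>_def by simp
      finally show ?thesis using t_nth k by simp
    qed
    then obtain w where w: "w \<in> L_set n" "\<forall>x\<in>forest_vertices n. collapse (w x) = t x"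
      using L_set_realises_signs[of n t] by blast
    have "map (collapse \<circ> w) xs = \<sigma>"
    proof (rule nth_equalityI)
      fix k assume "k < length (map (collapse \<circ> w) xs)"
      then have k: "k < length xs" by simp
      then have "xs ! k \<in> forest_vertices n"
        using nth_mem \<open>set xs = forest_vertices n\<close> by blast
      then show "map (collapse \<circ> w) xs ! k = \<sigma> ! k"
        using k w(2) t_nth by simp
    qed (simp add: len)
    then show ?thesis
      using w(1) xs by (intro image_eqI[of _ _ "(w, xs)"]) auto
  qed
  ultimately have "?\<phi> ` (L_set n \<times> ?E) = P_set n"
    by auto
  with inj show ?thesis
    unfolding bij_betw_def by blast
qed

section \<open>Preservation of descents and equality of the polynomials\<close>

text \<open>Neighbours in a linear extension are distinct and the later one is never below the
  earlier, as \<open>collapse_less_iff\<close> demands. The descent at the end depends only on a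
  sign, which \<open>collapse\<close> keeps.\<close>

lemma des_B_collapse:
  assumes w: "w \<in> L_set n" and xs: "xs \<in> linear_extensions (forest_vertices n) (forest_less n)"
  shows "des_B (map (collapse \<circ> w) xs) = des_B (map w xs)"
proof (rule des_B_map_cong)
  fix i assume i: "1 \<le> i" "i < length xs"
  have "xs ! (i - 1) \<in> forest_vertices n" "xs ! i \<in> forest_vertices n"
    using xs i nth_mem[of i xs] nth_mem[of "i - 1" xs] unfolding linear_extensions_def by auto
  moreover have "xs ! (i - 1) \<noteq> xs ! i"
    using xs i unfolding linear_extensions_def by (auto simp: nth_eq_iff_index_eq)
  moreover have "\<not> forest_less n (xs ! i) (xs ! (i - 1))"
  proof
    assume "forest_less n (xs ! i) (xs ! (i - 1))"
    then have "i < i - 1"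
      using xs i unfolding linear_extensions_def by auto
    then show False by simp
  qed
  ultimately show "(collapse \<circ> w) (xs ! i) < (collapse \<circ> w) (xs ! (i - 1)) \<longleftrightarrow>
      w (xs ! i) < w (xs ! (i - 1))"
    using collapse_less_iff[OF w] by simp
qed (simp add: collapse_pos_iff)

theorem theorem2p1:
  fixes n :: nat
  assumes "n \<ge> 1"
  shows "F_poly n = P_poly n"
proof -
  let ?E = "linear_extensions (forest_vertices n) (forest_less n)"
  have "(\<Sum>\<sigma>\<in>extension_words n w. monom 1 (des_B \<sigma>)) =
      (\<Sum>xs\<in>?E. monom (1::int) (des_B (map (collapse \<circ> w) xs)))" if w: "w \<in> L_set n" for w
  proof -
    \<comment> \<open>\<open>extension_words\<close> is a set, so coinciding words would count once.
      Distinct absolute labels make \<open>map w\<close> injective, and the sum can run over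
      extensions instead.\<close>
    have "inj_on (\<lambda>x. \<bar>w x\<bar>) (forest_vertices n)"
      using w unfolding L_set_def signed_labelings_def by blast
    then have "inj_on w (forest_vertices n)"
      by (auto simp: inj_on_def)
    then have "inj_on (map w) ?E"
      by (intro inj_onI) (auto simp: linear_extensions_def intro: map_inj_on)
    then show ?thesis
      unfolding extension_words_def by (simp add: sum.reindex des_B_collapse[OF w])
  qed
  \<comment> \<open>The set of extensions is the same for all \<open>w\<close>, so the double sum
    runs over a product, the domain of the bijection.\<close>
  then have "F_poly n =
      (\<Sum>(w, xs)\<in>L_set n \<times> ?E. monom 1 (des_B (map (collapse \<circ> w) xs)))"
    unfolding F_poly_def by (simp add: sum.cartesian_product)
  also have "\<dots> = P_poly n"
    unfolding P_poly_def
    by (subst sum.reindex_bij_betw[OF collapse_word_bij, symmetric]) (simp add: case_prod_unfold)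
  finally show ?thesis .
qed

end
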